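(* Let $n\ge 2$. For every $\kappa=(k_1,\dots,k_n)\in\{0,\dots,n-1\}^n$, let $m_1,\dots,m_r$ be the multiplicities of the $r$ distinct values occurring among $k_1,\dots,k_n$ (so $m_1+\cdots+m_r=n$). Then $$\prod_{i=1}^r m_i!\ \Big|\ E_n(\kappa).$$
   Context: $[n]=\{1,\dots,n\}$. An order-$n$ Latin square is an $n\times n$ matrix $L=(L(i,j))_{1\le i,j\le n}$ with entries in $[n]$ such that every row and every column is a permutation of $[n]$. An ascent of a permutation $\pi$ of $[n]$ is an index $i\in\{1,\dots,n-1\}$ with $\pi(i)<\pi(i+1)$. For a Latin square $L$ and $1\le i\le n$, $k_i(L)$ is the number of ascents of the $i$-th column $(L(1,i),\dots,L(n,i))$ viewed as a permutation of $[n]$. For $\kappa=(k_1,\dots,k_n)\in\{0,\dots,n-1\}^n$, the Latin Eulerian number $E_n(\kappa)$ is the number of order-$n$ Latin squares $L$ with $k_i(L)=k_i$ for all $i=1,\dots,n$. *)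

theory Defs
  imports Main "HOL-Library.FuncSet"
begin

(* Matrices and permutations are indexed by {1..n}.  The extensional function space (values
   undefined outside the index range) makes each matrix be represented by exactly one function,
   so that counting functions is counting matrices. *)
definition latin_squares :: "nat \<Rightarrow> (nat \<Rightarrow> nat \<Rightarrow> nat) set" where
  "latin_squares n =
     {L \<in> {1..n} \<rightarrow>\<^sub>E {1..n} \<rightarrow>\<^sub>E {1..n}.
        (\<forall>i\<in>{1..n}. bij_betw (\<lambda>j. L i j) {1..n} {1..n}) \<and>
        (\<forall>j\<in>{1..n}. bij_betw (\<lambda>i. L i j) {1..n} {1..n})}"

definition ascents :: "nat \<Rightarrow> (nat \<Rightarrow> nat) \<Rightarrow> nat set" where
  "ascents n \<pi> = {i \<in> {1..n-1}. \<pi> i < \<pi> (i + 1)}"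

definition column_ascents :: "nat \<Rightarrow> (nat \<Rightarrow> nat \<Rightarrow> nat) \<Rightarrow> nat \<Rightarrow> nat" where
  "column_ascents n L j = card (ascents n (\<lambda>i. L i j))"

definition latin_eulerian :: "nat \<Rightarrow> (nat \<Rightarrow> nat) \<Rightarrow> nat" where
  "latin_eulerian n \<kappa> =
     card {L \<in> latin_squares n. \<forall>j\<in>{1..n}. column_ascents n L j = \<kappa> j}"

definition multiplicity_in :: "nat \<Rightarrow> (nat \<Rightarrow> nat) \<Rightarrow> nat \<Rightarrow> nat" where
  "multiplicity_in n \<kappa> v = card {j \<in> {1..n}. \<kappa> j = v}"

(* The cardinality in latin_eulerian is that of a finite set, hence a genuine count. *)
lemma finite_latin_squares: "finite (latin_squares n)"
proof -
  have "finite ({1..n} \<rightarrow>\<^sub>E ({1..n} \<rightarrow>\<^sub>E {1..n}))"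
    by (intro finite_PiE) auto
  then show ?thesis
    unfolding latin_squares_def by simp
qed

end

theory Submission
  imports Defs "HOL-Combinatorics.Permutations"
begin

text \<open>
  Permuting the columns of a Latin square gives a Latin square, and permutes the ascent numbers of
  its columns in the same way. Hence the group of all permutations \<open>\<sigma>\<close> of the column indices with
  \<open>\<kappa> \<circ> \<sigma> = \<kappa>\<close> acts on the Latin squares counted by \<open>E\<^sub>n(\<kappa>)\<close>. The action is free: the entries of the
  first row are distinct, so the first row alone determines which permutation was applied. All
  orbits therefore have the size of the group, which must divide the number of squares
  (\<open>card_dvd_if_free_action\<close>). The group is a direct product of the symmetric groups on the
  fibres of \<open>\<kappa>\<close>, so its order is the product of the factorials of the multiplicities
  (\<open>card_fibre_preserving_permutations\<close>).
\<close>

section \<open>Permutations preserving the fibres of a function\<close>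

definition fibre_preserving_permutations :: "('a \<Rightarrow> 'b) \<Rightarrow> 'a set \<Rightarrow> ('a \<Rightarrow> 'a) set" where
  "fibre_preserving_permutations f A = {\<sigma>. \<sigma> permutes A \<and> (\<forall>x\<in>A. f (\<sigma> x) = f x)}"

text \<open>
  Such a permutation splits into its restrictions to the fibres; conversely, permutations of the
  individual fibres are glued together by letting the fibre of a point decide which of them acts
  there.
\<close>

lemma card_fibre_preserving_permutations:
  assumes "finite A"
  shows "card (fibre_preserving_permutations f A) = (\<Prod>v\<in>f ` A. fact (card {x\<in>A. f x = v}))"
proof -
  let ?F = "\<lambda>v. {x\<in>A. f x = v}"
  let ?P = "\<Pi>\<^sub>E v\<in>f ` A. {\<tau>. \<tau> permutes ?F v}"
  define split where "split = (\<lambda>\<sigma>. \<lambda>v\<in>f ` A. \<lambda>x. if x \<in> ?F v then \<sigma> x else x)"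
  define glue where "glue = (\<lambda>\<tau> x. if x \<in> A then \<tau> (f x) x else x)"
  have "bij_betw split (fibre_preserving_permutations f A) ?P"
  proof (rule bij_betw_byWitness[where f' = glue])
    show "\<forall>\<sigma>\<in>fibre_preserving_permutations f A. glue (split \<sigma>) = \<sigma>"
      by (auto simp: fibre_preserving_permutations_def glue_def split_def fun_eq_iff
          permutes_not_in)
    show "\<forall>\<tau>\<in>?P. split (glue \<tau>) = \<tau>"
    proof
      fix \<tau> assume \<tau>: "\<tau> \<in> ?P"
      show "split (glue \<tau>) = \<tau>"
      proof (rule ext)
        fix v
        show "split (glue \<tau>) v = \<tau> v"
        proof (cases "v \<in> f ` A")
          case True
          then have "\<tau> v permutes ?F v" using \<tau> by (auto dest: PiE_mem)
          then have out: "\<tau> v x = x" if "x \<notin> ?F v" for x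
            using that by (rule permutes_not_in)
          show ?thesis
          proof (rule ext)
            fix x
            show "split (glue \<tau>) v x = \<tau> v x"
              using True out[of x] by (auto simp: split_def glue_def)
          qed
        next
          case False
          then show ?thesis using PiE_arb[OF \<tau> False] by (auto simp: split_def)
        qed
      qed
    qed
    show "split ` fibre_preserving_permutations f A \<subseteq> ?P"
    proof (rule image_subsetI)
      fix \<sigma> assume "\<sigma> \<in> fibre_preserving_permutations f A"
      then have perm: "\<sigma> permutes A" and fib: "\<And>x. x \<in> A \<Longrightarrow> f (\<sigma> x) = f x"
        by (auto simp: fibre_preserving_permutations_def)
      have "(\<lambda>x. if x \<in> ?F v then \<sigma> x else x) permutes ?F v" for v
      proof (rule inj_imp_permutes)
        show "inj_on (\<lambda>x. if x \<in> ?F v then \<sigma> x else x) (?F v)"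
          using inj_on_subset[OF permutes_inj[OF perm] subset_UNIV, of "?F v"]
          by (simp add: inj_on_def)
        show "finite (?F v)" using assms by simp
      qed (auto simp: fib permutes_in_image[OF perm])
      then show "split \<sigma> \<in> ?P" by (auto simp: split_def)
    qed
    show "glue ` ?P \<subseteq> fibre_preserving_permutations f A"
    proof (rule image_subsetI)
      fix \<tau> assume \<tau>: "\<tau> \<in> ?P"
      have perm: "\<tau> (f x) permutes ?F (f x)" if "x \<in> A" for x
        using PiE_mem[OF \<tau>, of "f x"] that by simp
      have closed: "\<tau> (f x) x \<in> A" "f (\<tau> (f x) x) = f x" if "x \<in> A" for x
        using permutes_in_image[OF perm[OF that], of x] that by auto
      have "glue \<tau> permutes A"
      proof (rule inj_imp_permutes)
        show "inj_on (glue \<tau>) A"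
        proof (rule inj_onI)
          fix x y assume xy: "x \<in> A" "y \<in> A" and "glue \<tau> x = glue \<tau> y"
          then have eq: "\<tau> (f x) x = \<tau> (f y) y" by (simp add: glue_def)
          then have "f x = f y" using closed xy by metis
          with eq have "\<tau> (f x) x = \<tau> (f x) y" by simp
          then show "x = y" using permutes_inj[OF perm[OF xy(1)]] by (rule injD[rotated])
        qed
      qed (use assms closed in \<open>auto simp: glue_def\<close>)
      then show "glue \<tau> \<in> fibre_preserving_permutations f A"
        using closed by (auto simp: fibre_preserving_permutations_def glue_def)
    qed
  qed
  then have "card (fibre_preserving_permutations f A) = card ?P"
    by (rule bij_betw_same_card)
  also have "\<dots> = (\<Prod>v\<in>f ` A. fact (card (?F v)))"
    using assms by (simp add: card_PiE card_permutations[OF refl])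
  finally show ?thesis .
qed

lemma
  assumes "\<sigma> \<in> fibre_preserving_permutations f A"
  shows fibre_preserving_permutations_permutes: "\<sigma> permutes A"
    and fibre_preserving_permutations_fibre: "x \<in> A \<Longrightarrow> f (\<sigma> x) = f x"
  using assms by (auto simp: fibre_preserving_permutations_def)

lemma id_fibre_preserving: "id \<in> fibre_preserving_permutations f A"
  by (simp add: fibre_preserving_permutations_def permutes_id)

lemma comp_fibre_preserving:
  assumes "\<sigma> \<in> fibre_preserving_permutations f A" "\<tau> \<in> fibre_preserving_permutations f A"
  shows "\<sigma> \<circ> \<tau> \<in> fibre_preserving_permutations f A"
  using assms by (auto simp: fibre_preserving_permutations_def permutes_compose permutes_in_image)

lemma inv_fibre_preserving:
  assumes "\<sigma> \<in> fibre_preserving_permutations f A"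
  shows "inv \<sigma> \<in> fibre_preserving_permutations f A"
proof -
  have perm: "\<sigma> permutes A"
    using assms by (rule fibre_preserving_permutations_permutes)
  have "f (inv \<sigma> x) = f x" if "x \<in> A" for x
  proof -
    have "inv \<sigma> x \<in> A" using permutes_inv[OF perm] that by (simp add: permutes_in_image)
    from fibre_preserving_permutations_fibre[OF assms this] show ?thesis
      by (simp add: permutes_inverses[OF perm])
  qed
  then show ?thesis
    by (simp add: fibre_preserving_permutations_def permutes_inv[OF perm])
qed

section \<open>Free actions\<close>

text \<open>
  Freeness makes every orbit a bijective image of the group, and the orbits partition the set. The
  law for \<open>\<sigma> \<circ> \<tau>\<close> is that of a right action, as precomposition with a permutation gives it.
\<close>

lemma card_dvd_if_free_action:
  fixes G :: "('a \<Rightarrow> 'a) set" and act :: "('a \<Rightarrow> 'a) \<Rightarrow> 's \<Rightarrow> 's"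
  assumes "finite S"
    and id: "id \<in> G" and comp: "\<And>\<sigma> \<tau>. \<sigma> \<in> G \<Longrightarrow> \<tau> \<in> G \<Longrightarrow> \<sigma> \<circ> \<tau> \<in> G"
    and inv: "\<And>\<sigma>. \<sigma> \<in> G \<Longrightarrow> inv \<sigma> \<in> G" and surj: "\<And>\<sigma>. \<sigma> \<in> G \<Longrightarrow> surj \<sigma>"
    and closed: "\<And>\<sigma> x. \<sigma> \<in> G \<Longrightarrow> x \<in> S \<Longrightarrow> act \<sigma> x \<in> S"
    and act_id: "\<And>x. x \<in> S \<Longrightarrow> act id x = x"
    and act_comp: "\<And>\<sigma> \<tau> x. \<sigma> \<in> G \<Longrightarrow> \<tau> \<in> G \<Longrightarrow> x \<in> S \<Longrightarrow> act (\<sigma> \<circ> \<tau>) x = act \<tau> (act \<sigma> x)"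
    and free: "\<And>x. x \<in> S \<Longrightarrow> inj_on (\<lambda>\<sigma>. act \<sigma> x) G"
  shows "card G dvd card S"
proof -
  define r where "r = {(x, y). x \<in> S \<and> (\<exists>\<sigma>\<in>G. y = act \<sigma> x)}"
  have "equiv S r"
  proof (rule equivI)
    show "r \<subseteq> S \<times> S" using closed by (auto simp: r_def)
    show "refl_on S r"
    proof (rule refl_onI)
      fix x assume x: "x \<in> S"
      show "(x, x) \<in> r"
        unfolding r_def by (intro CollectI case_prodI conjI x bexI[OF _ id] act_id[OF x, symmetric])
    qed
    show "sym r"
    proof (rule symI)
      fix x y assume "(x, y) \<in> r"
      then obtain \<sigma> where x: "x \<in> S" and \<sigma>: "\<sigma> \<in> G" and y: "y = act \<sigma> x"
        by (auto simp: r_def)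
      have "act (inv \<sigma>) y = act (\<sigma> \<circ> inv \<sigma>) x"
        unfolding y using act_comp[OF \<sigma> inv[OF \<sigma>] x] by simp
      also have "\<sigma> \<circ> inv \<sigma> = id"
        using surj[OF \<sigma>] by (simp add: surj_iff)
      also have "act id x = x" by (rule act_id[OF x])
      finally have "x = act (inv \<sigma>) y" by (rule sym)
      moreover have "y \<in> S" unfolding y by (rule closed[OF \<sigma> x])
      ultimately show "(y, x) \<in> r"
        unfolding r_def by (intro CollectI case_prodI conjI bexI[OF _ inv[OF \<sigma>]])
    qed
    show "trans r"
    proof (rule transI)
      fix x y z assume "(x, y) \<in> r" "(y, z) \<in> r"
      then obtain \<sigma> \<tau> where x: "x \<in> S" and \<sigma>: "\<sigma> \<in> G" and \<tau>: "\<tau> \<in> G"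
        and z: "z = act \<tau> (act \<sigma> x)"
        by (auto simp: r_def)
      from z have "z = act (\<sigma> \<circ> \<tau>) x" by (simp only: act_comp[OF \<sigma> \<tau> x])
      then show "(x, z) \<in> r"
        unfolding r_def by (intro CollectI case_prodI conjI x bexI[OF _ comp[OF \<sigma> \<tau>]])
    qed
  qed
  moreover have "card G dvd card X" if X: "X \<in> S // r" for X
  proof -
    from X obtain x where x: "x \<in> S" and "X = r `` {x}" by (rule quotientE)
    then have "X = (\<lambda>\<sigma>. act \<sigma> x) ` G" by (auto simp: r_def)
    then show ?thesis using card_image[OF free[OF x]] by simp
  qed
  ultimately show ?thesis by (rule equiv_imp_dvd_card[OF \<open>finite S\<close>])
qed

section \<open>Permuting the columns of a Latin square\<close>

text \<open>
  Rows outside the index range must stay \<open>undefined\<close>, and \<open>undefined \<circ> \<sigma>\<close> need not be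
  \<open>undefined\<close>; hence the restriction.
\<close>

definition permute_columns ::
    "nat \<Rightarrow> (nat \<Rightarrow> nat) \<Rightarrow> (nat \<Rightarrow> nat \<Rightarrow> nat) \<Rightarrow> nat \<Rightarrow> nat \<Rightarrow> nat" where
  "permute_columns n \<sigma> L = (\<lambda>i\<in>{1..n}. L i \<circ> \<sigma>)"

lemma permute_columns_latin_squares:
  assumes L: "L \<in> latin_squares n" and \<sigma>: "\<sigma> permutes {1..n}"
  shows "permute_columns n \<sigma> L \<in> latin_squares n"
proof -
  have rows: "L i \<in> {1..n} \<rightarrow>\<^sub>E {1..n}" if "i \<in> {1..n}" for i
    using L that by (auto simp: latin_squares_def)
  have "L i \<circ> \<sigma> \<in> {1..n} \<rightarrow>\<^sub>E {1..n}" if i: "i \<in> {1..n}" for i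
  proof (rule PiE_I)
    fix j assume "j \<in> {1..n}"
    then have "\<sigma> j \<in> {1..n}" by (simp only: permutes_in_image[OF \<sigma>])
    then show "(L i \<circ> \<sigma>) j \<in> {1..n}" using PiE_mem[OF rows[OF i]] by simp
  next
    fix j assume "j \<notin> {1..n}"
    then show "(L i \<circ> \<sigma>) j = undefined"
      using PiE_arb[OF rows[OF i]] permutes_not_in[OF \<sigma>] by simp
  qed
  then have "permute_columns n \<sigma> L \<in> {1..n} \<rightarrow>\<^sub>E {1..n} \<rightarrow>\<^sub>E {1..n}"
    unfolding permute_columns_def by (rule restrict_PiE_iff[THEN iffD2, OF ballI])
  moreover have "bij_betw (\<lambda>j. permute_columns n \<sigma> L i j) {1..n} {1..n}" if i: "i \<in> {1..n}" for i
  proof -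
    have "bij_betw (L i) {1..n} {1..n}" using L i by (simp add: latin_squares_def)
    from bij_betw_trans[OF permutes_imp_bij[OF \<sigma>] this] show ?thesis
      using i by (simp add: permute_columns_def comp_def)
  qed
  moreover have "bij_betw (\<lambda>i. permute_columns n \<sigma> L i j) {1..n} {1..n}" if "j \<in> {1..n}" for j
  proof -
    have "\<sigma> j \<in> {1..n}" using that by (simp only: permutes_in_image[OF \<sigma>])
    then have "bij_betw (\<lambda>i. L i (\<sigma> j)) {1..n} {1..n}" using L by (simp add: latin_squares_def)
    then show ?thesis
      by (subst bij_betw_cong[where g = "\<lambda>i. L i (\<sigma> j)"]) (simp_all add: permute_columns_def)
  qed
  ultimately show ?thesis by (simp add: latin_squares_def)
qed

lemma column_ascents_permute_columns:
  "column_ascents n (permute_columns n \<sigma> L) j = column_ascents n L (\<sigma> j)"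
proof -
  have "ascents n (\<lambda>i. permute_columns n \<sigma> L i j) = ascents n (\<lambda>i. L i (\<sigma> j))"
    by (auto simp: ascents_def permute_columns_def)
  then show ?thesis by (simp add: column_ascents_def)
qed

lemma permute_columns_id:
  assumes "L \<in> latin_squares n"
  shows "permute_columns n id L = L"
  using assms by (auto simp: permute_columns_def latin_squares_def intro: PiE_restrict)

lemma permute_columns_comp:
  "permute_columns n (\<sigma> \<circ> \<tau>) L = permute_columns n \<tau> (permute_columns n \<sigma> L)"
  by (auto simp: permute_columns_def fun_eq_iff)

text \<open>Freeness of the action, read off from the first row.\<close>

lemma inj_on_permute_columns:
  assumes L: "L \<in> latin_squares n" and "n \<ge> 1"
  shows "inj_on (\<lambda>\<sigma>. permute_columns n \<sigma> L) {\<sigma>. \<sigma> permutes {1..n}}"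
proof (rule inj_onI)
  fix \<sigma> \<tau>
  assume "\<sigma> \<in> {\<sigma>. \<sigma> permutes {1..n}}" "\<tau> \<in> {\<sigma>. \<sigma> permutes {1..n}}"
  then have \<sigma>: "\<sigma> permutes {1..n}" and \<tau>: "\<tau> permutes {1..n}" by auto
  assume "permute_columns n \<sigma> L = permute_columns n \<tau> L"
  then have "permute_columns n \<sigma> L 1 = permute_columns n \<tau> L 1" by simp
  then have row: "L 1 (\<sigma> j) = L 1 (\<tau> j)" for j
    using \<open>n \<ge> 1\<close> by (simp add: permute_columns_def fun_eq_iff)
  have inj: "inj_on (L 1) {1..n}"
    using L \<open>n \<ge> 1\<close> by (auto simp: latin_squares_def bij_betw_def)
  show "\<sigma> = \<tau>"
  proof (rule ext)
    fix j
    show "\<sigma> j = \<tau> j"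
    proof (cases "j \<in> {1..n}")
      case True
      then have "\<sigma> j \<in> {1..n}" "\<tau> j \<in> {1..n}"
        by (simp_all only: permutes_in_image[OF \<sigma>] permutes_in_image[OF \<tau>])
      then show ?thesis using inj_onD[OF inj row] by blast
    next
      case False
      then show ?thesis using permutes_not_in[OF \<sigma>] permutes_not_in[OF \<tau>] by simp
    qed
  qed
qed

theorem theorem3p1:
  fixes n :: nat and \<kappa> :: "nat \<Rightarrow> nat"
  assumes "n \<ge> 2"
    and "\<kappa> \<in> {1..n} \<rightarrow> {0..n-1}"
  shows "(\<Prod>v \<in> \<kappa> ` {1..n}. fact (multiplicity_in n \<kappa> v)) dvd latin_eulerian n \<kappa>"
proof -
  let ?G = "fibre_preserving_permutations \<kappa> {1..n}"
  let ?S = "{L \<in> latin_squares n. \<forall>j\<in>{1..n}. column_ascents n L j = \<kappa> j}"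
  have "card ?G dvd card ?S"
  proof (rule card_dvd_if_free_action[where act = "permute_columns n"])
    show "finite ?S" using finite_latin_squares by simp
    show "surj \<sigma>" if "\<sigma> \<in> ?G" for \<sigma>
      using fibre_preserving_permutations_permutes[OF that] by (rule permutes_surj)
    show "permute_columns n \<sigma> L \<in> ?S" if \<sigma>: "\<sigma> \<in> ?G" and L: "L \<in> ?S" for \<sigma> L
    proof -
      have perm: "\<sigma> permutes {1..n}" using \<sigma> by (rule fibre_preserving_permutations_permutes)
      have "column_ascents n L (\<sigma> j) = \<kappa> j" if j: "j \<in> {1..n}" for j
      proof -
        have "\<sigma> j \<in> {1..n}" using j by (simp only: permutes_in_image[OF perm])
        then show ?thesis using L fibre_preserving_permutations_fibre[OF \<sigma> j] by simp
      qed
      then show ?thesis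
        using L perm by (simp add: permute_columns_latin_squares column_ascents_permute_columns)
    qed
    show "inj_on (\<lambda>\<sigma>. permute_columns n \<sigma> L) ?G" if "L \<in> ?S" for L
      by (rule inj_on_subset[OF inj_on_permute_columns])
        (use that \<open>n \<ge> 2\<close> in \<open>auto intro: fibre_preserving_permutations_permutes\<close>)
  qed (auto simp: permute_columns_id permute_columns_comp
      intro: id_fibre_preserving comp_fibre_preserving inv_fibre_preserving)
  then show ?thesis
    by (simp add: card_fibre_preserving_permutations latin_eulerian_def multiplicity_in_def)
qed

end
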